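(* Let $P$ be a polyomino, let $\min(P)$ be the minimum number of non-attacking rooks that dominate $P$, and let $\max(P)$ be the maximum number of non-attacking rooks that can be placed on $P$. Then $\min(P)\ge\lceil \max(P)/2\rceil$, and for every integer $k$ with $\min(P)\le k\le\max(P)$ there exists a dominating set of $k$ non-attacking rooks on $P$.
   Context: A polyomino is a finite union of unit squares (tiles) of the standard grid in $\mathbb{R}^2$ with connected interior. Two tiles of $P$ are in the same row (resp. column) of $P$ if the segment joining their centers is horizontal (resp. vertical) and contained in $P$. A rook on a tile guards that tile and every tile in the same row or column of $P$. A set of rooks dominates $P$ if every tile is guarded by some rook. A set of rooks on distinct tiles is non-attacking if no two are in the same row or column of $P$. *)

theory Defs
  imports "HOL-Analysis.Analysis"
begin

text \<open>The pair \<open>(i, j)\<close> of integers names the closed unit square of the standard grid whose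
  lower left corner is the point \<open>(i, j)\<close>.\<close>

definition tile :: "int \<times> int \<Rightarrow> (real \<times> real) set" where
  "tile c = {real_of_int (fst c) .. real_of_int (fst c) + 1} \<times>
            {real_of_int (snd c) .. real_of_int (snd c) + 1}"

definition center :: "int \<times> int \<Rightarrow> real \<times> real" where
  "center c = (real_of_int (fst c) + 1 / 2, real_of_int (snd c) + 1 / 2)"

definition polyomino :: "(real \<times> real) set \<Rightarrow> bool" where
  "polyomino P \<longleftrightarrow>
     (\<exists>C. finite C \<and> P = (\<Union>c\<in>C. tile c)) \<and> connected (interior P)"

definition tiles :: "(real \<times> real) set \<Rightarrow> (int \<times> int) set" where
  "tiles P = {c. tile c \<subseteq> P}"

definition same_row :: "(real \<times> real) set \<Rightarrow> int \<times> int \<Rightarrow> int \<times> int \<Rightarrow> bool" where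
  "same_row P a b \<longleftrightarrow> a \<in> tiles P \<and> b \<in> tiles P \<and>
     snd (center a) = snd (center b) \<and> closed_segment (center a) (center b) \<subseteq> P"

definition same_column :: "(real \<times> real) set \<Rightarrow> int \<times> int \<Rightarrow> int \<times> int \<Rightarrow> bool" where
  "same_column P a b \<longleftrightarrow> a \<in> tiles P \<and> b \<in> tiles P \<and>
     fst (center a) = fst (center b) \<and> closed_segment (center a) (center b) \<subseteq> P"

definition guards :: "(real \<times> real) set \<Rightarrow> int \<times> int \<Rightarrow> int \<times> int \<Rightarrow> bool" where
  "guards P r t \<longleftrightarrow> t = r \<or> same_row P r t \<or> same_column P r t"

text \<open>A set of rooks on distinct tiles is identified with the set of tiles it occupies.\<close>

definition dominates :: "(real \<times> real) set \<Rightarrow> (int \<times> int) set \<Rightarrow> bool" where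
  "dominates P R \<longleftrightarrow> R \<subseteq> tiles P \<and> (\<forall>t\<in>tiles P. \<exists>r\<in>R. guards P r t)"

definition non_attacking :: "(real \<times> real) set \<Rightarrow> (int \<times> int) set \<Rightarrow> bool" where
  "non_attacking P R \<longleftrightarrow> R \<subseteq> tiles P \<and>
     (\<forall>a\<in>R. \<forall>b\<in>R. a \<noteq> b \<longrightarrow> \<not> same_row P a b \<and> \<not> same_column P a b)"

text \<open>For a polyomino both sets of cardinalities below are finite and nonempty: a non-attacking
  set that is maximal with respect to inclusion dominates.\<close>

definition min_rooks :: "(real \<times> real) set \<Rightarrow> nat" where
  "min_rooks P = Min {card R | R. non_attacking P R \<and> dominates P R}"

definition max_rooks :: "(real \<times> real) set \<Rightarrow> nat" where
  "max_rooks P = Max {card R | R. non_attacking P R}"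

end

theory Submission imports Defs begin

text \<open>Tiles are the edges of a bipartite graph whose vertices are the rows and the columns of
  \<open>P\<close>. Non-attacking sets are matchings, and non-attacking dominating sets are maximal matchings.
  Every edge of a matching \<open>N\<close> meets a vertex covered by a maximal matching \<open>M\<close>, which covers
  \<open>2 |M|\<close> vertices, so \<open>|N| \<le> 2 |M|\<close>. If \<open>|M| < |N|\<close>, then \<open>M\<close> can be augmented to a matching
  with one more edge that still covers all vertices covered by \<open>M\<close> and is therefore again maximal.\<close>

section \<open>Matchings in bipartite graphs\<close>

definition matching :: "('e \<Rightarrow> 'u) \<Rightarrow> ('e \<Rightarrow> 'v) \<Rightarrow> 'e set \<Rightarrow> bool" where
  "matching r c M \<longleftrightarrow> inj_on r M \<and> inj_on c M"

lemma matching_subset: "matching r c M \<Longrightarrow> A \<subseteq> M \<Longrightarrow> matching r c A"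
  by (auto simp: matching_def intro: inj_on_subset)

lemma matching_insert:
  "matching r c M \<Longrightarrow> r e \<notin> r ` M \<Longrightarrow> c e \<notin> c ` M \<Longrightarrow> matching r c (insert e M)"
  by (auto simp: matching_def)

text \<open>Instead of following an alternating path, the induction removes one edge from each
  matching, \<open>f\<close> from \<open>M\<close> and \<open>e\<close> from \<open>N\<close>, where
  \<open>e\<close> and \<open>f\<close> share a column. Keeping all vertices of \<open>M\<close>
  covered is what later preserves domination.\<close>

lemma matching_augment:
  assumes "finite M" "finite N" "matching r c M" "matching r c N" "card M < card N"
  shows "\<exists>M'. M' \<subseteq> M \<union> N \<and> matching r c M' \<and> card M' = Suc (card M) \<and>
           r ` M \<subseteq> r ` M' \<and> c ` M \<subseteq> c ` M'"
  using assms
proof (induction "card M" arbitrary: M N rule: less_induct)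
  case less
  \<comment> \<open>A matching covers as many rows as it has edges, so \<open>N\<close> covers a row
    that \<open>M\<close> misses.\<close>
  have "card (r ` M) < card (r ` N)"
    using less.prems by (simp add: matching_def card_image)
  then have "\<not> r ` N \<subseteq> r ` M"
    using card_mono[of "r ` M" "r ` N"] less.prems(1) by auto
  then obtain e where e: "e \<in> N" "r e \<notin> r ` M"
    by auto
  show ?case
  proof (cases "c e \<in> c ` M")
    case False
    have "e \<notin> M"
      using e by auto
    then show ?thesis
      using e False less.prems
      by (intro exI[of _ "insert e M"]) (auto intro: matching_insert)
  next
    case True
    then obtain f where f: "f \<in> M" "c f = c e"
      by auto
    define M1 where "M1 = M - {f}"
    define N1 where "N1 = N - {e}"
    have fin: "finite M1" "finite N1" and match: "matching r c M1" "matching r c N1"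
      using less.prems by (auto simp: M1_def N1_def intro: matching_subset)
    have card_M: "card M = Suc (card M1)"
      unfolding M1_def using less.prems(1) f(1) by (rule card.remove)
    have card_N: "card N = Suc (card N1)"
      unfolding N1_def using less.prems(2) e(1) by (rule card.remove)
    \<comment> \<open>Both sides lost exactly one edge, so the strict inequality survives.\<close>
    obtain M2 where M2: "M2 \<subseteq> M1 \<union> N1" "matching r c M2" "card M2 = Suc (card M1)"
        "r ` M1 \<subseteq> r ` M2" "c ` M1 \<subseteq> c ` M2"
      using less.hyps[of M1 N1] fin match card_M card_N less.prems(5) by auto
    have "finite M2"
      using M2(1) fin finite_subset by blast
    have M: "M = insert f M1"
      using f by (auto simp: M1_def)
    \<comment> \<open>Edges of \<open>M2\<close> come from \<open>M1\<close> or \<open>N1\<close>.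
      Neither set meets the row of \<open>e\<close> or the column shared by \<open>e\<close> and
      \<open>f\<close>, hence \<open>M2\<close> leaves both free.\<close>
    have r_inj: "\<And>x. x \<in> N1 \<Longrightarrow> r x \<noteq> r e" and c_inj: "\<And>x. x \<in> N1 \<Longrightarrow> c x \<noteq> c e"
        "\<And>x. x \<in> M1 \<Longrightarrow> c x \<noteq> c f"
      using less.prems(3,4) e(1) f(1) by (auto simp: matching_def N1_def M1_def inj_on_def)
    have r_e: "r e \<notin> r ` M2"
      using M2(1) r_inj e(2) M by fastforce
    have c_e: "c e \<notin> c ` M2"
      using M2(1) c_inj f(2) by fastforce
    \<comment> \<open>The column of \<open>e\<close> and \<open>f\<close> is free in \<open>M2\<close>, so either edge may be added to cover it;
      \<open>f\<close> is needed only when its row is not yet covered.\<close>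
    define g where "g = (if r f \<in> r ` M2 then e else f)"
    have g: "r g \<notin> r ` M2" "c g \<notin> c ` M2" "c g = c f" "g \<in> M \<union> N" "r f \<in> r ` insert g M2"
      using r_e c_e e f by (auto simp: g_def)
    have "insert g M2 \<subseteq> M \<union> N"
      using g(4) M2(1) by (auto simp: M1_def N1_def)
    moreover have "matching r c (insert g M2)"
      using matching_insert M2(2) g(1,2) .
    moreover have "card (insert g M2) = Suc (card M)"
      using g(1) \<open>finite M2\<close> M2(3) card_M by (auto simp: card_insert_if)
    moreover have "r ` M \<subseteq> r ` insert g M2"
      using M2(4) g(5) M by auto
    moreover have "c ` M \<subseteq> c ` insert g M2"
      using M2(5) g(3) M by auto
    ultimately show ?thesis
      by blast
  qed
qed

text \<open>Charge each edge of \<open>N\<close> to a row or column covered by \<open>M\<close>.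
  Since \<open>N\<close> is a matching, no row and no column is charged twice.\<close>

lemma card_matching_le:
  assumes "finite M" "finite N" "matching r c N"
    and cover: "\<And>e. e \<in> N \<Longrightarrow> r e \<in> r ` M \<or> c e \<in> c ` M"
  shows "card N \<le> 2 * card M"
proof -
  define A where "A = {e \<in> N. r e \<in> r ` M}"
  define B where "B = {e \<in> N. c e \<in> c ` M}"
  have "inj_on r A" "inj_on c B"
    using assms(3) by (auto simp: A_def B_def matching_def intro: inj_on_subset)
  then have "card A \<le> card (r ` M)" "card B \<le> card (c ` M)"
    using assms(1) by (auto intro!: card_inj_on_le simp: A_def B_def)
  then have "card A \<le> card M" "card B \<le> card M"
    using card_image_le[OF assms(1), of r] card_image_le[OF assms(1), of c] by linarith+
  moreover have "N = A \<union> B"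
    using cover by (auto simp: A_def B_def)
  ultimately show ?thesis
    using card_Un_le[of A B] by simp
qed

section \<open>Rows and columns of a polyomino\<close>

text \<open>Centers have half-integer coordinates, so they avoid all grid lines. Hence a tile inside
  a union of tiles must be one of them, which makes \<open>tiles P\<close> finite.\<close>

lemma center_in_tile_iff: "center c \<in> tile d \<longleftrightarrow> c = d"
proof
  assume "center c \<in> tile d"
  then have "fst c = fst d" "snd c = snd d"
    unfolding center_def tile_def mem_Times_iff fst_conv snd_conv atLeastAtMost_iff
    by linarith+
  then show "c = d"
    by (simp add: prod_eq_iff)
qed (simp add: center_def tile_def)

lemma center_in_polyomino: "a \<in> tiles P \<Longrightarrow> center a \<in> P"
  using center_in_tile_iff[of a a] by (auto simp: tiles_def)

lemma finite_tiles:
  assumes "polyomino P"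
  shows "finite (tiles P)"
proof -
  obtain C where C: "finite C" "P = (\<Union>c\<in>C. tile c)"
    using assms by (auto simp: polyomino_def)
  have "tiles P \<subseteq> C"
  proof
    fix a
    assume "a \<in> tiles P"
    then obtain d where "d \<in> C" "center a \<in> tile d"
      using center_in_polyomino C(2) by blast
    then show "a \<in> C"
      by (simp add: center_in_tile_iff)
  qed
  then show ?thesis
    using C(1) finite_subset by blast
qed

text \<open>The three points lie on one line, in any order; this gives transitivity of
  \<open>same_column\<close>.\<close>

lemma closed_segment_subset_Un_same_fst:
  fixes p q s :: "'a::real_vector \<times> real"
  assumes "fst p = fst q" "fst q = fst s"
  shows "closed_segment p s \<subseteq> closed_segment p q \<union> closed_segment q s"
  using assms
  by (auto simp: closed_segment_same_fst closed_segment_eq_real_ivl)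

lemma closed_segment_subset_Un_same_snd:
  fixes p q s :: "real \<times> 'a::real_vector"
  assumes "snd p = snd q" "snd q = snd s"
  shows "closed_segment p s \<subseteq> closed_segment p q \<union> closed_segment q s"
  using assms
  by (auto simp: closed_segment_same_snd closed_segment_eq_real_ivl)

lemma same_row_refl: "a \<in> tiles P \<Longrightarrow> same_row P a a"
  by (simp add: same_row_def center_in_polyomino)

lemma same_column_refl: "a \<in> tiles P \<Longrightarrow> same_column P a a"
  by (simp add: same_column_def center_in_polyomino)

lemma same_row_sym: "same_row P a b \<Longrightarrow> same_row P b a"
  by (simp add: same_row_def closed_segment_commute)

lemma same_column_sym: "same_column P a b \<Longrightarrow> same_column P b a"
  by (simp add: same_column_def closed_segment_commute)

lemma same_row_trans: "same_row P a b \<Longrightarrow> same_row P b c \<Longrightarrow> same_row P a c"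
  using closed_segment_subset_Un_same_snd[of "center a" "center b" "center c"]
  by (auto simp: same_row_def)

lemma same_column_trans: "same_column P a b \<Longrightarrow> same_column P b c \<Longrightarrow> same_column P a c"
  using closed_segment_subset_Un_same_fst[of "center a" "center b" "center c"]
  by (auto simp: same_column_def)

text \<open>A row is encoded as an equivalence class of tiles, so that it can serve as a vertex of
  the bipartite graph. Off \<open>tiles P\<close> the class is empty.\<close>

definition row_of :: "(real \<times> real) set \<Rightarrow> int \<times> int \<Rightarrow> (int \<times> int) set" where
  "row_of P a = {b. same_row P a b}"

definition column_of :: "(real \<times> real) set \<Rightarrow> int \<times> int \<Rightarrow> (int \<times> int) set" where
  "column_of P a = {b. same_column P a b}"

text \<open>Membership of \<open>a\<close> in \<open>tiles P\<close> rules out equality of two empty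
  classes.\<close>

lemma row_of_eq_iff: "a \<in> tiles P \<Longrightarrow> row_of P a = row_of P b \<longleftrightarrow> same_row P a b"
  unfolding row_of_def set_eq_iff mem_Collect_eq
  by (meson same_row_refl same_row_sym same_row_trans)

lemma column_of_eq_iff: "a \<in> tiles P \<Longrightarrow> column_of P a = column_of P b \<longleftrightarrow> same_column P a b"
  unfolding column_of_def set_eq_iff mem_Collect_eq
  by (meson same_column_refl same_column_sym same_column_trans)

section \<open>Rook placements as matchings\<close>

lemma non_attacking_iff_matching:
  "non_attacking P R \<longleftrightarrow> R \<subseteq> tiles P \<and> matching (row_of P) (column_of P) R"
proof (cases "R \<subseteq> tiles P")
  case True
  then have "\<And>a b. a \<in> R \<Longrightarrow> same_row P a b \<longleftrightarrow> row_of P a = row_of P b"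
      "\<And>a b. a \<in> R \<Longrightarrow> same_column P a b \<longleftrightarrow> column_of P a = column_of P b"
    using row_of_eq_iff column_of_eq_iff by blast+
  then have "non_attacking P R \<longleftrightarrow> R \<subseteq> tiles P \<and> (\<forall>a\<in>R. \<forall>b\<in>R. a \<noteq> b \<longrightarrow>
      row_of P a \<noteq> row_of P b \<and> column_of P a \<noteq> column_of P b)"
    by (simp add: non_attacking_def)
  then show ?thesis
    unfolding matching_def inj_on_def by meson
qed (simp add: non_attacking_def)

text \<open>In this form domination depends only on which rows and columns are covered, and it can
  only gain when more are covered. The case \<open>t = r\<close> of \<open>guards\<close> is
  absorbed by equality of classes.\<close>

lemma dominates_iff:
  "dominates P R \<longleftrightarrow> R \<subseteq> tiles P \<and>
     (\<forall>t\<in>tiles P. row_of P t \<in> row_of P ` R \<or> column_of P t \<in> column_of P ` R)"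
proof -
  have "guards P r t \<longleftrightarrow> row_of P t = row_of P r \<or> column_of P t = column_of P r"
    if "r \<in> tiles P" for r t
    unfolding guards_def using row_of_eq_iff[OF that, of t] column_of_eq_iff[OF that, of t] by auto
  then have "(\<exists>r\<in>R. guards P r t) \<longleftrightarrow>
      row_of P t \<in> row_of P ` R \<or> column_of P t \<in> column_of P ` R"
    if "R \<subseteq> tiles P" for t
    unfolding image_iff using that by (meson subsetD)
  then show ?thesis
    unfolding dominates_def by meson
qed

text \<open>A rook could be added on any unguarded tile.\<close>

lemma max_card_non_attacking_dominates:
  assumes "finite (tiles P)" "non_attacking P R"
    and max: "\<And>S. non_attacking P S \<Longrightarrow> card S \<le> card R"
  shows "dominates P R"
  unfolding dominates_iff
proof (intro conjI ballI)
  show R: "R \<subseteq> tiles P"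
    using assms(2) by (simp add: non_attacking_def)
  fix t
  assume t: "t \<in> tiles P"
  show "row_of P t \<in> row_of P ` R \<or> column_of P t \<in> column_of P ` R"
  proof (rule ccontr)
    assume neg: "\<not> ?thesis"
    then have "non_attacking P (insert t R)"
      using assms(2) t by (auto simp: non_attacking_iff_matching intro: matching_insert)
    moreover have "card (insert t R) = Suc (card R)"
      using neg finite_subset[OF R assms(1)] by (auto simp: card_insert_if)
    ultimately show False
      using max[of "insert t R"] by simp
  qed
qed

lemma non_attacking_dominating_augment:
  assumes "finite (tiles P)" "non_attacking P R" "dominates P R"
    and "non_attacking P S" "card R < card S"
  shows "\<exists>R'. non_attacking P R' \<and> dominates P R' \<and> card R' = Suc (card R)"
proof -
  have sub: "R \<subseteq> tiles P" "S \<subseteq> tiles P"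
    and match: "matching (row_of P) (column_of P) R" "matching (row_of P) (column_of P) S"
    using assms by (auto simp: non_attacking_iff_matching)
  obtain R' where R': "R' \<subseteq> R \<union> S" "matching (row_of P) (column_of P) R'"
      "card R' = Suc (card R)" "row_of P ` R \<subseteq> row_of P ` R'" "column_of P ` R \<subseteq> column_of P ` R'"
    using matching_augment[OF finite_subset[OF sub(1)] finite_subset[OF sub(2)] match] assms(1,5)
    by blast
  have "R' \<subseteq> tiles P"
    using R'(1) sub by blast
  moreover have "dominates P R'"
    using assms(3) \<open>R' \<subseteq> tiles P\<close> R'(4,5) unfolding dominates_iff by blast
  ultimately show ?thesis
    using R'(2,3) by (auto simp: non_attacking_iff_matching)
qed

theorem theorem15:
  fixes P :: "(real \<times> real) set"
  assumes "polyomino P"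
  shows "\<lceil>real (max_rooks P) / 2\<rceil> \<le> int (min_rooks P) \<and>
    (\<forall>k::nat. min_rooks P \<le> k \<and> k \<le> max_rooks P \<longrightarrow>
      (\<exists>R. non_attacking P R \<and> dominates P R \<and> card R = k))"
proof -
  have fin: "finite (tiles P)"
    using finite_tiles[OF assms] .
  have fin_rooks: "finite R" if "non_attacking P R" for R
    using that fin finite_subset by (auto simp: non_attacking_def)
  have "{R. non_attacking P R} \<subseteq> Pow (tiles P)"
    by (auto simp: non_attacking_def)
  then have "finite {R. non_attacking P R}"
    using fin finite_subset by blast
  then have fin_max: "finite {card R |R. non_attacking P R}"
    and fin_min: "finite {card R |R. non_attacking P R \<and> dominates P R}"
    by auto
  have "non_attacking P {}"
    by (simp add: non_attacking_def)
  then have "max_rooks P \<in> {card R |R. non_attacking P R}"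
    unfolding max_rooks_def using fin_max by (intro Max_in) auto
  then obtain S where S: "non_attacking P S" "card S = max_rooks P"
    by auto
  \<comment> \<open>Maximality makes \<open>S\<close> dominate, so the set whose minimum is
    \<open>min_rooks P\<close> is nonempty.\<close>
  have "card R \<le> card S" if "non_attacking P R" for R
    unfolding S(2) max_rooks_def using fin_max that by (intro Max_ge) auto
  then have "dominates P S"
    using max_card_non_attacking_dominates[OF fin S(1)] by blast
  then have "min_rooks P \<in> {card R |R. non_attacking P R \<and> dominates P R}"
    unfolding min_rooks_def using fin_min S(1) by (intro Min_in) auto
  then obtain M where M: "non_attacking P M" "dominates P M" "card M = min_rooks P"
    by auto
  have "max_rooks P \<le> 2 * min_rooks P"
    unfolding S(2)[symmetric] M(3)[symmetric]
  proof (rule card_matching_le[of M S "row_of P" "column_of P"])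
    show "row_of P t \<in> row_of P ` M \<or> column_of P t \<in> column_of P ` M" if "t \<in> S" for t
      using that M(2) S(1) by (auto simp: dominates_iff non_attacking_def)
  qed (use fin_rooks S(1) M(1) in \<open>auto simp: non_attacking_iff_matching\<close>)
  then have "\<lceil>real (max_rooks P) / 2\<rceil> \<le> int (min_rooks P)"
    by (simp add: ceiling_le_iff)
  moreover have "\<exists>R. non_attacking P R \<and> dominates P R \<and> card R = k"
    if "min_rooks P \<le> k" "k \<le> max_rooks P" for k
    using that
  \<comment> \<open>Climb from \<open>M\<close> one rook at a time. As long as \<open>k\<close> is
    below \<open>max_rooks P\<close>, the maximum placement \<open>S\<close> has more rooks than the
    current one and can augment it.\<close>
  proof (induction k rule: dec_induct)
    case base
    then show ?case
      using M by blast
  next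
    case (step k)
    then obtain R where "non_attacking P R" "dominates P R" "card R = k"
      by auto
    then show ?case
      using non_attacking_dominating_augment[OF fin _ _ S(1), of R] S(2) step.prems by auto
  qed
  ultimately show ?thesis
    by blast
qed

end
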